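(* Let $X$ be a Hausdorff topological space, let $F\subset BC(X)$ be a closed subalgebra that separates points from closed sets, and let $F'\subset F$ be such that $\overline{\mathbb{A}(F')}=F$ (closure in the sup norm). Then $e_{F'}X$ is a compactification of $X$ and $e_{F'}X\cong e_FX$ as compactifications of $X$.
   Context: $BC(X)$ is the algebra of bounded continuous real functions on $X$ with the sup norm. $F\subset BC(X)$ separates points from closed sets if for every closed $C\subset X$ and $x\in X\setminus C$ there is $f\in F$ with $f(x)\notin\overline{f(C)}$. $\mathbb{A}(F')$ is the algebra generated by $F'$. For any family $H\subset BC(X)$, $e_H:X\to\prod_{f\in H}[\inf f,\sup f]$, $x\mapsto(f(x))_{f\in H}$, the target having the product topology, and $e_HX:=\overline{e_H(X)}$. A compactification of $X$ is a compact Hausdorff space $\alpha X$ with a map $\alpha:X\to\alpha X$ that is a homeomorphism onto its image and has dense image; saying that $e_{F'}X$ is a compactification refers to the map $e_{F'}$. For two compactifications, $\alpha X\ge\gamma X$ means there is a continuous $h:\alpha X\to\gamma X$ with $h\circ\alpha=\gamma$, and $\alpha X\cong\gamma X$ means $\alpha X\ge\gamma X$ and $\gamma X\ge\alpha X$. *)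

theory Defs
  imports "HOL-Analysis.Analysis"
begin

(* HOL-Analysis makes bounded continuous functions a normed space under the sup norm;
   the pointwise product turns BC(X) = ('a \<Rightarrow>\<^sub>C real) into a normed algebra. *)

lemma mult_cont: "(\<lambda>x. f x * g x) \<in> bcontfun"
  if f: "f \<in> bcontfun" and g: "g \<in> bcontfun"
  for f g :: "'a::topological_space \<Rightarrow> 'b::real_normed_algebra"
proof -
  from f obtain a where a: "\<And>x. norm (f x) \<le> a" and cf: "continuous_on UNIV f"
    by (auto simp: bcontfun_def bounded_iff)
  from g obtain b where b: "\<And>x. norm (g x) \<le> b" and cg: "continuous_on UNIV g"
    by (auto simp: bcontfun_def bounded_iff)
  show "(\<lambda>x. f x * g x) \<in> bcontfun"
  proof (rule bcontfun_normI)
    show "continuous_on UNIV (\<lambda>x. f x * g x)"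
      using cf cg by (rule continuous_on_mult)
    show "norm (f x * g x) \<le> a * b" for x
      using norm_mult_ineq[of "f x" "g x"] a[of x] b[of x]
        mult_mono'[OF a[of x] b[of x] norm_ge_zero norm_ge_zero] by linarith
  qed
qed

instantiation bcontfun :: (topological_space, real_normed_algebra) real_normed_algebra
begin

definition times_bcontfun :: "('a \<Rightarrow>\<^sub>C 'b) \<Rightarrow> ('a \<Rightarrow>\<^sub>C 'b) \<Rightarrow> 'a \<Rightarrow>\<^sub>C 'b" where
  "times_bcontfun f g = Bcontfun (\<lambda>x. apply_bcontfun f x * apply_bcontfun g x)"

lemma apply_bcontfun_times:
  "apply_bcontfun (f * g) x = apply_bcontfun f x * apply_bcontfun g x"
  for f g :: "'a \<Rightarrow>\<^sub>C 'b"
  by (simp add: times_bcontfun_def Bcontfun_inverse mult_cont apply_bcontfun)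

instance
proof
  fix f g h :: "'a \<Rightarrow>\<^sub>C 'b" and c :: real
  show "f * g * h = f * (g * h)"
    by (rule bcontfun_eqI) (simp add: apply_bcontfun_times mult.assoc)
  show "(f + g) * h = f * h + g * h"
    by (rule bcontfun_eqI) (simp add: apply_bcontfun_times plus_bcontfun.rep_eq distrib_right)
  show "f * (g + h) = f * g + f * h"
    by (rule bcontfun_eqI) (simp add: apply_bcontfun_times plus_bcontfun.rep_eq distrib_left)
  show "c *\<^sub>R f * g = c *\<^sub>R (f * g)"
    by (rule bcontfun_eqI) (simp add: apply_bcontfun_times scaleR_bcontfun.rep_eq)
  show "f * c *\<^sub>R g = c *\<^sub>R (f * g)"
    by (rule bcontfun_eqI) (simp add: apply_bcontfun_times scaleR_bcontfun.rep_eq)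
  show "norm (f * g) \<le> norm f * norm g"
  proof (rule norm_bound)
    fix x
    have "norm (apply_bcontfun f x * apply_bcontfun g x)
        \<le> norm (apply_bcontfun f x) * norm (apply_bcontfun g x)"
      by (rule norm_mult_ineq)
    also have "\<dots> \<le> norm f * norm g"
      by (intro mult_mono' norm_bounded norm_ge_zero)
    finally show "norm (apply_bcontfun (f * g) x) \<le> norm f * norm g"
      by (simp add: apply_bcontfun_times)
  qed
qed

end

(* Subalgebras need not contain the constant functions. *)

definition is_subalgebra :: "'a::real_algebra set \<Rightarrow> bool" where
  "is_subalgebra A \<longleftrightarrow> subspace A \<and> (\<forall>f\<in>A. \<forall>g\<in>A. f * g \<in> A)"

definition generated_algebra :: "'a::real_algebra set \<Rightarrow> 'a set" where
  "generated_algebra S = is_subalgebra hull S"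

definition separates_points_from_closed_sets :: "('a::topological_space \<Rightarrow>\<^sub>C real) set \<Rightarrow> bool" where
  "separates_points_from_closed_sets F \<longleftrightarrow>
     (\<forall>C x. closed C \<and> x \<notin> C \<longrightarrow>
        (\<exists>f\<in>F. apply_bcontfun f x \<notin> closure (apply_bcontfun f ` C)))"

definition evaluation_map ::
  "('a::topological_space \<Rightarrow>\<^sub>C real) set \<Rightarrow> 'a \<Rightarrow> (('a \<Rightarrow>\<^sub>C real) \<Rightarrow> real)" where
  "evaluation_map H x = (\<lambda>f\<in>H. apply_bcontfun f x)"

definition evaluation_cube ::
  "('a::topological_space \<Rightarrow>\<^sub>C real) set \<Rightarrow> (('a \<Rightarrow>\<^sub>C real) \<Rightarrow> real) topology" where
  "evaluation_cube H =
     product_topology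
       (\<lambda>f. top_of_set {(INF x. apply_bcontfun f x) .. (SUP x. apply_bcontfun f x)}) H"

definition evaluation_closure ::
  "('a::topological_space \<Rightarrow>\<^sub>C real) set \<Rightarrow> (('a \<Rightarrow>\<^sub>C real) \<Rightarrow> real) topology" where
  "evaluation_closure H =
     subtopology (evaluation_cube H) (evaluation_cube H closure_of range (evaluation_map H))"

definition is_compactification :: "'b topology \<Rightarrow> ('a::topological_space \<Rightarrow> 'b) \<Rightarrow> bool" where
  "is_compactification Y \<alpha> \<longleftrightarrow>
     compact_space Y \<and> Hausdorff_space Y \<and>
     embedding_map euclidean Y \<alpha> \<and> Y closure_of range \<alpha> = topspace Y"

(* The order and the equivalence relate compactifications only. *)

definition compactification_ge ::
  "'b topology \<Rightarrow> ('a::topological_space \<Rightarrow> 'b) \<Rightarrow> 'c topology \<Rightarrow> ('a \<Rightarrow> 'c) \<Rightarrow> bool" where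
  "compactification_ge Y \<alpha> Z \<gamma> \<longleftrightarrow>
     is_compactification Y \<alpha> \<and> is_compactification Z \<gamma> \<and>
     (\<exists>h. continuous_map Y Z h \<and> h \<circ> \<alpha> = \<gamma>)"

definition compactification_equiv ::
  "'b topology \<Rightarrow> ('a::topological_space \<Rightarrow> 'b) \<Rightarrow> 'c topology \<Rightarrow> ('a \<Rightarrow> 'c) \<Rightarrow> bool" where
  "compactification_equiv Y \<alpha> Z \<gamma> \<longleftrightarrow>
     compactification_ge Y \<alpha> Z \<gamma> \<and> compactification_ge Z \<gamma> Y \<alpha>"

end

(* Restricting coordinates from F to F' maps e_F X continuously onto e_F' X. A point p of e_F X is
   a limit of evaluations, hence f |-> p f is a contractive algebra homomorphism on F, determined
   by its values on the generating set F'. So the restriction is injective, and by compactness it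
   is a homeomorphism, which carries the embedding e_F to e_F'. *)
theory Submission
  imports Defs
begin

section \<open>The evaluation cube and the closure of the image of the space in it\<close>

lemma apply_bcontfun_le_SUP:
  fixes f :: "'a::topological_space \<Rightarrow>\<^sub>C real"
  shows "apply_bcontfun f x \<le> (SUP x. apply_bcontfun f x)"
  by (intro cSUP_upper bounded_imp_bdd_above) auto

lemma INF_le_apply_bcontfun:
  fixes f :: "'a::topological_space \<Rightarrow>\<^sub>C real"
  shows "(INF x. apply_bcontfun f x) \<le> apply_bcontfun f x"
  by (intro cINF_lower bounded_imp_bdd_below) auto

lemma evaluation_map_apply: "f \<in> H \<Longrightarrow> evaluation_map H x f = apply_bcontfun f x"
  by (simp add: evaluation_map_def)

lemma compact_space_evaluation_cube: "compact_space (evaluation_cube H)"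
  by (simp add: evaluation_cube_def compact_space_product_topology compact_space_subtopology)

lemma Hausdorff_space_evaluation_cube: "Hausdorff_space (evaluation_cube H)"
  by (simp add: evaluation_cube_def Hausdorff_space_product_topology Hausdorff_space_subtopology)

lemma continuous_map_evaluation_cube: "continuous_map euclidean (evaluation_cube H) (evaluation_map H)"
  by (auto simp: evaluation_cube_def continuous_map_componentwise evaluation_map_apply
      evaluation_map_def continuous_map_in_subtopology apply_bcontfun_le_SUP INF_le_apply_bcontfun)

lemma range_evaluation_map_subset: "range (evaluation_map H) \<subseteq> topspace (evaluation_cube H)"
  using continuous_map_image_subset_topspace[OF continuous_map_evaluation_cube] by auto

lemma topspace_evaluation_closure:
  "topspace (evaluation_closure H) = evaluation_cube H closure_of range (evaluation_map H)"
  by (simp add: evaluation_closure_def closure_of_subset_topspace inf.absorb2)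

lemma evaluation_map_in_topspace: "evaluation_map H x \<in> topspace (evaluation_closure H)"
  using closure_of_subset[OF range_evaluation_map_subset]
  by (auto simp: topspace_evaluation_closure)

lemma compact_space_evaluation_closure: "compact_space (evaluation_closure H)"
  unfolding evaluation_closure_def
  by (intro compact_space_subtopology closedin_compact_space compact_space_evaluation_cube) simp

lemma Hausdorff_space_evaluation_closure: "Hausdorff_space (evaluation_closure H)"
  unfolding evaluation_closure_def
  by (intro Hausdorff_space_subtopology Hausdorff_space_evaluation_cube)

lemma evaluation_map_dense:
  "evaluation_closure H closure_of range (evaluation_map H) = topspace (evaluation_closure H)"
  using closure_of_subset[OF range_evaluation_map_subset[of H]]
  unfolding topspace_evaluation_closure
  by (simp add: evaluation_closure_def closure_of_subtopology inf.absorb2)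

lemma continuous_map_evaluation_map:
  "continuous_map euclidean (evaluation_closure H) (evaluation_map H)"
  using evaluation_map_in_topspace[of H] unfolding topspace_evaluation_closure
  by (auto simp: evaluation_closure_def continuous_map_in_subtopology continuous_map_evaluation_cube)

section \<open>Points of the closure as functionals on the family\<close>

lemma continuous_map_evaluation_coordinate:
  assumes "f \<in> H"
  shows "continuous_map (evaluation_closure H) euclideanreal (\<lambda>p. p f)"
proof -
  have "continuous_map (evaluation_cube H)
      (top_of_set {(INF x. apply_bcontfun f x) .. (SUP x. apply_bcontfun f x)}) (\<lambda>p. p f)"
    unfolding evaluation_cube_def using assms by (rule continuous_map_product_projection)
  then show ?thesis
    by (simp add: evaluation_closure_def continuous_map_in_subtopology continuous_map_from_subtopology)
qed

text \<open>Continuous maps into a Hausdorff space that agree on a dense set agree everywhere, and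
  the evaluations are dense. Algebraic identities thus pass from evaluations to every point of the
  closure.\<close>

lemma evaluation_closure_eqI:
  assumes "p \<in> topspace (evaluation_closure H)"
    and "continuous_map (evaluation_closure H) euclideanreal u"
    and "continuous_map (evaluation_closure H) euclideanreal v"
    and "\<And>x. u (evaluation_map H x) = v (evaluation_map H x)"
  shows "u p = v p"
  by (rule forall_in_closure_of_eq[of p "evaluation_closure H" "range (evaluation_map H)"])
    (use assms in \<open>auto simp: evaluation_map_dense\<close>)

text \<open>At an evaluation this is the pointwise bound by the sup norm. Being a closed condition
  on the point, it survives passage to limits. It serves to extend agreement of two points from an
  algebra to its uniform closure.\<close>

lemma evaluation_closure_dist_le:
  assumes p: "p \<in> topspace (evaluation_closure H)" and f: "f \<in> H" and g: "g \<in> H"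
  shows "\<bar>p f - p g\<bar> \<le> dist f g"
proof (rule forall_in_closure_of[of p "evaluation_closure H" "range (evaluation_map H)"])
  show "p \<in> evaluation_closure H closure_of range (evaluation_map H)"
    using p by (simp add: evaluation_map_dense)
next
  fix q assume "q \<in> range (evaluation_map H)"
  then show "\<bar>q f - q g\<bar> \<le> dist f g"
    using f g dist_bounded[of f _ g] by (auto simp: evaluation_map_apply dist_real_def)
next
  have "continuous_map (evaluation_closure H) euclideanreal (\<lambda>q. \<bar>q f - q g\<bar>)"
    using f g by (intro continuous_intros continuous_map_evaluation_coordinate)
  from closedin_continuous_map_preimage[OF this, of "{..dist f g}"]
  show "closedin (evaluation_closure H)
      {q \<in> topspace (evaluation_closure H). \<bar>q f - q g\<bar> \<le> dist f g}"
    by simp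
qed

text \<open>Sums, real multiples and products are respected by evaluations, hence by all points of
  the closure. The set in question is therefore the equalizer of two algebra homomorphisms on
  \<open>F\<close>.\<close>

lemma is_subalgebra_evaluation_agree:
  assumes F: "is_subalgebra F"
    and p: "p \<in> topspace (evaluation_closure F)" and q: "q \<in> topspace (evaluation_closure F)"
  shows "is_subalgebra {f \<in> F. p f = q f}"
proof -
  have sub: "subspace F" and mult: "\<And>f g. f \<in> F \<Longrightarrow> g \<in> F \<Longrightarrow> f * g \<in> F"
    using F by (auto simp: is_subalgebra_def)
  note coord = continuous_map_evaluation_coordinate
  have zero: "r 0 = 0" if "r \<in> topspace (evaluation_closure F)" for r
    by (rule evaluation_closure_eqI[OF that])
      (auto intro!: coord simp: evaluation_map_apply subspace_0[OF sub] zero_bcontfun.rep_eq)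
  have add: "r (f + g) = r f + r g"
    if "r \<in> topspace (evaluation_closure F)" "f \<in> F" "g \<in> F" for r f g
    by (rule evaluation_closure_eqI[OF that(1)])
      (use that subspace_add[OF sub] in
        \<open>auto intro!: coord continuous_map_add simp: evaluation_map_apply plus_bcontfun.rep_eq\<close>)
  have scale: "r (c *\<^sub>R f) = c * r f"
    if "r \<in> topspace (evaluation_closure F)" "f \<in> F" for r c f
    by (rule evaluation_closure_eqI[OF that(1)])
      (use that subspace_scale[OF sub] in
        \<open>auto intro!: coord continuous_map_real_mult simp: evaluation_map_apply scaleR_bcontfun.rep_eq\<close>)
  have times: "r (f * g) = r f * r g"
    if "r \<in> topspace (evaluation_closure F)" "f \<in> F" "g \<in> F" for r f g
    by (rule evaluation_closure_eqI[OF that(1)])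
      (use that mult in
        \<open>auto intro!: coord continuous_map_real_mult simp: evaluation_map_apply apply_bcontfun_times\<close>)
  show ?thesis
    using p q sub mult
    by (auto simp: is_subalgebra_def subspace_def zero add scale times)
qed

lemma evaluation_closure_eq_if_eq_on_generators:
  assumes F: "is_subalgebra F" and F': "F' \<subseteq> F" and gen: "closure (generated_algebra F') = F"
    and p: "p \<in> topspace (evaluation_closure F)" and q: "q \<in> topspace (evaluation_closure F)"
    and eq: "\<And>f. f \<in> F' \<Longrightarrow> p f = q f"
  shows "p = q"
proof
  fix f
  show "p f = q f"
  proof (cases "f \<in> F")
    case False
    \<comment> \<open>Points of the product are extensional functions, so outside \<open>F\<close>
      both take the value \<open>undefined\<close>.\<close>
    have "p \<in> topspace (evaluation_cube F)" "q \<in> topspace (evaluation_cube F)"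
      using p q by (auto simp: evaluation_closure_def)
    with False show ?thesis
      by (auto simp: evaluation_cube_def PiE_def extensional_def)
  next
    case True
    \<comment> \<open>The functions on which \<open>p\<close> and \<open>q\<close> agree form a
      subalgebra containing \<open>F'\<close>, and the hull is the smallest such.\<close>
    have sub: "generated_algebra F' \<subseteq> {f \<in> F. p f = q f}"
      unfolding generated_algebra_def
      by (rule hull_minimal) (use F' eq is_subalgebra_evaluation_agree[OF F p q] in auto)
    have "\<bar>p f - q f\<bar> \<le> 0 + e" if "e > 0" for e
    proof -
      \<comment> \<open>Replacing \<open>f\<close> by \<open>g\<close> costs at most
        \<open>dist g f\<close> at \<open>p\<close> and again at \<open>q\<close>, hence the choice
        of \<open>e / 2\<close>.\<close>
      have "f \<in> closure (generated_algebra F')" using True gen by simp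
      then obtain g where g: "g \<in> generated_algebra F'" "dist g f < e / 2"
        using \<open>e > 0\<close> by (auto simp: closure_approachable dest!: spec[of _ "e / 2"])
      then have "g \<in> F" "p g = q g" using sub by auto
      then show ?thesis
        using evaluation_closure_dist_le[OF p, of g f] evaluation_closure_dist_le[OF q, of g f]
          True g(2) by simp
    qed
    from field_le_epsilon[OF this] show ?thesis by simp
  qed
qed

section \<open>The embedding given by a separating family\<close>

lemma embedding_map_evaluation_map:
  fixes F :: "('a::t1_space \<Rightarrow>\<^sub>C real) set"
  assumes sep: "separates_points_from_closed_sets F"
  shows "embedding_map euclidean (evaluation_closure F) (evaluation_map F)"
proof -
  let ?e = "evaluation_map F" and ?Y = "evaluation_closure F"
  have inj: "inj ?e"
  proof (rule injI, rule ccontr)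
    fix x y assume eq: "?e x = ?e y" and "x \<noteq> y"
    \<comment> \<open>In a T1 space the singleton of \<open>y\<close> is closed, so separation from
      closed sets yields separation of points.\<close>
    then obtain f where "f \<in> F" "apply_bcontfun f x \<notin> closure (apply_bcontfun f ` {y})"
      using sep unfolding separates_points_from_closed_sets_def
      by (metis closed_singleton singletonD)
    with fun_cong[OF eq, of f] show False by (simp add: evaluation_map_apply)
  qed
  have cont: "continuous_map euclidean (subtopology ?Y (range ?e)) ?e"
    by (simp add: continuous_map_in_subtopology continuous_map_evaluation_map)
  have "open_map euclidean (subtopology ?Y (range ?e)) ?e"
    unfolding open_map_def
  proof (intro allI impI)
    fix U :: "'a set" assume "openin euclidean U"
    then have U: "closed (- U)" by (simp add: open_closed)
    show "openin (subtopology ?Y (range ?e)) (?e ` U)"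
    proof (subst openin_subopen, intro ballI)
      fix p assume "p \<in> ?e ` U"
      then obtain x where x: "x \<in> U" "p = ?e x" by blast
      then obtain f where f: "f \<in> F" "apply_bcontfun f x \<notin> closure (apply_bcontfun f ` (- U))"
        using sep U unfolding separates_points_from_closed_sets_def by (metis ComplD)
      \<comment> \<open>The coordinate \<open>f\<close> cuts out an open neighbourhood of
        \<open>p\<close>: an evaluation in \<open>V\<close> has its \<open>f\<close>-value outside
        the image of the complement of \<open>U\<close>, so it comes from a point of
        \<open>U\<close>.\<close>
      define V where "V = {q \<in> topspace ?Y. q f \<in> - closure (apply_bcontfun f ` (- U))}"
      have "openin ?Y V"
        unfolding V_def
        by (rule openin_continuous_map_preimage[OF continuous_map_evaluation_coordinate[OF f(1)]])
          (simp add: open_Compl)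
      then have "openin (subtopology ?Y (range ?e)) (V \<inter> range ?e)"
        by (rule openin_subtopology_Int)
      moreover have "p \<in> V \<inter> range ?e"
        using x f by (simp add: V_def evaluation_map_in_topspace evaluation_map_apply)
      moreover have "V \<inter> range ?e \<subseteq> ?e ` U"
      proof clarify
        fix y assume "?e y \<in> V"
        then have "apply_bcontfun f y \<notin> closure (apply_bcontfun f ` (- U))"
          using f(1) by (simp add: V_def evaluation_map_apply)
        then have "y \<in> U" using closure_subset[of "apply_bcontfun f ` (- U)"] by blast
        then show "?e y \<in> ?e ` U" by blast
      qed
      ultimately show "\<exists>T. openin (subtopology ?Y (range ?e)) T \<and> p \<in> T \<and> T \<subseteq> ?e ` U"
        by blast
    qed
  qed
  with inj cont have "embedding_map euclidean (subtopology ?Y (range ?e)) ?e"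
    by (intro injective_open_imp_embedding_map) auto
  then show ?thesis by (simp add: embedding_map_in_subtopology)
qed

text \<open>The closure of the image in a compact Hausdorff cube is compact and Hausdorff, with
  dense image by construction; only the embedding property remains.\<close>

lemma is_compactification_evaluation_closure:
  "is_compactification (evaluation_closure H) (evaluation_map H) \<longleftrightarrow>
    embedding_map euclidean (evaluation_closure H) (evaluation_map H)"
  by (simp add: is_compactification_def compact_space_evaluation_closure
      Hausdorff_space_evaluation_closure evaluation_map_dense)

section \<open>Restriction of coordinates to the generating family\<close>

lemma restrict_evaluation_map:
  "F' \<subseteq> F \<Longrightarrow> restrict (evaluation_map F x) F' = evaluation_map F' x"
  by (auto simp: evaluation_map_def fun_eq_iff restrict_def)

lemma continuous_map_restrict_evaluation_closure:
  assumes F': "F' \<subseteq> F"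
  shows "continuous_map (evaluation_closure F) (evaluation_closure F') (\<lambda>p. restrict p F')"
proof -
  have "continuous_map (evaluation_cube F) (evaluation_cube F') (\<lambda>p. restrict p F')"
    using F' by (auto simp: evaluation_cube_def continuous_map_componentwise
        intro: continuous_map_product_projection)
  \<comment> \<open>A continuous map sends the closure of a set into the closure of its image, and
    restriction turns evaluations on \<open>F\<close> into evaluations on \<open>F'\<close>.\<close>
  moreover from continuous_map_image_closure_subset[OF this, of "range (evaluation_map F)"]
  have "(\<lambda>p. restrict p F') \<in> topspace (evaluation_closure F) \<rightarrow> topspace (evaluation_closure F')"
    by (auto simp: topspace_evaluation_closure image_image restrict_evaluation_map[OF F'])
  ultimately show ?thesis
    unfolding topspace_evaluation_closure
    by (auto simp: evaluation_closure_def continuous_map_in_subtopology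
        continuous_map_from_subtopology)
qed

text \<open>A continuous bijection from a compact space onto a Hausdorff space is a homeomorphism.
  Generation of \<open>F\<close> by \<open>F'\<close> enters only through injectivity.\<close>

lemma homeomorphic_map_restrict_evaluation_closure:
  assumes F: "is_subalgebra F" and F': "F' \<subseteq> F" and gen: "closure (generated_algebra F') = F"
  shows "homeomorphic_map (evaluation_closure F) (evaluation_closure F') (\<lambda>p. restrict p F')"
proof (rule continuous_imp_homeomorphic_map)
  let ?h = "\<lambda>p. restrict p F'" and ?Y = "evaluation_closure F" and ?Z = "evaluation_closure F'"
  show cont: "continuous_map ?Y ?Z ?h"
    using F' by (rule continuous_map_restrict_evaluation_closure)
  show "compact_space ?Y" by (rule compact_space_evaluation_closure)
  show "Hausdorff_space ?Z" by (rule Hausdorff_space_evaluation_closure)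
  \<comment> \<open>Surjectivity: the image is closed and contains the dense set of evaluations on
    \<open>F'\<close>.\<close>
  have "closedin ?Z (?h ` topspace ?Y)"
    using continuous_imp_closed_map[OF cont compact_space_evaluation_closure
        Hausdorff_space_evaluation_closure]
    by (simp add: closed_map_def)
  moreover have "range (evaluation_map F') \<subseteq> ?h ` topspace ?Y"
    by (metis F' restrict_evaluation_map evaluation_map_in_topspace image_eqI image_subsetI)
  ultimately have "?Z closure_of range (evaluation_map F') \<subseteq> ?h ` topspace ?Y"
    by (intro closure_of_minimal)
  with continuous_map_image_subset_topspace[OF cont] show "?h ` topspace ?Y = topspace ?Z"
    by (simp add: evaluation_map_dense)
  show "inj_on ?h (topspace ?Y)"
  proof (rule inj_onI)
    fix p q assume pq: "p \<in> topspace ?Y" "q \<in> topspace ?Y" and eq: "?h p = ?h q"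
    have "p f = q f" if "f \<in> F'" for f
      using fun_cong[OF eq, of f] that by simp
    with F F' gen pq show "p = q" by (rule evaluation_closure_eq_if_eq_on_generators)
  qed
qed

theorem theorem2p12:
  fixes F F' :: "('a::t2_space \<Rightarrow>\<^sub>C real) set"
  assumes "is_subalgebra F" and "closed F"
    and "separates_points_from_closed_sets F"
    and "F' \<subseteq> F" and "closure (generated_algebra F') = F"
  shows "is_compactification (evaluation_closure F') (evaluation_map F') \<and>
    compactification_equiv (evaluation_closure F') (evaluation_map F')
      (evaluation_closure F) (evaluation_map F)"
proof -
  let ?h = "\<lambda>p. restrict p F'"
  have h: "homeomorphic_map (evaluation_closure F) (evaluation_closure F') ?h"
    using assms(1,4,5) by (rule homeomorphic_map_restrict_evaluation_closure)
  then obtain k where k: "homeomorphic_maps (evaluation_closure F) (evaluation_closure F') ?h k"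
    unfolding homeomorphic_map_maps by blast
  have he: "?h \<circ> evaluation_map F = evaluation_map F'"
    using assms(4) by (auto simp: fun_eq_iff restrict_evaluation_map)
  \<comment> \<open>The inverse \<open>k\<close> undoes restriction on the closure, which contains
    every evaluation on \<open>F\<close>.\<close>
  have ke: "k \<circ> evaluation_map F' = evaluation_map F"
  proof
    fix x
    have "(k \<circ> evaluation_map F') x = k (?h (evaluation_map F x))"
      by (simp add: flip: he)
    also have "\<dots> = evaluation_map F x"
      using k evaluation_map_in_topspace[of F x] unfolding homeomorphic_maps_def by blast
    finally show "(k \<circ> evaluation_map F') x = evaluation_map F x" .
  qed
  have emb: "embedding_map euclidean (evaluation_closure F) (evaluation_map F)"
    using assms(3) by (rule embedding_map_evaluation_map)
  \<comment> \<open>Separation is assumed for \<open>F\<close> and may fail for \<open>F'\<close>,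
    so the embedding property of \<open>evaluation_map F'\<close> is obtained by composing that of
    \<open>evaluation_map F\<close> with the homeomorphism.\<close>
  have "embedding_map (evaluation_closure F) (evaluation_closure F') ?h"
    using h homeomorphic_imp_surjective_map[OF h] by (simp add: embedding_map_def)
  from embedding_map_compose[OF emb this]
  have emb': "embedding_map euclidean (evaluation_closure F') (evaluation_map F')"
    by (simp only: he)
  \<comment> \<open>Restriction and its inverse witness the two comparisons.\<close>
  have "continuous_map (evaluation_closure F) (evaluation_closure F') ?h"
    and "continuous_map (evaluation_closure F') (evaluation_closure F) k"
    using k by (auto simp: homeomorphic_maps_def)
  with he ke emb emb' show ?thesis
    unfolding compactification_equiv_def compactification_ge_def
      is_compactification_evaluation_closure by blast
qed

end
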